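(* Let $n\ge 1$ be a fixed integer and let $C$ be the coassociative coalgebra with basis $\{U_{ij}:1\le i,j\le n\}$ and coproduct $\Delta U_{ij}=\sum_{k=1}^n U_{ik}\otimes U_{kj}$. Define the linear map $D:C\to C$ by $$D(U_{ij})=\sum_{k=1}^n\bigl(U_{kj}-U_{ik}\bigr).$$ Then $D$ is a Leibniz coderivation, i.e. $\Delta D=(id\otimes D)\Delta+(D\otimes id)\Delta$.
   Context: The field $k$ is $\mathbb{R}$ or $\mathbb{C}$. A linear map $D:C\to C$ on a coassociative coalgebra $(C,\Delta)$ is a (Leibniz) coderivation with respect to $\Delta$ if $\Delta D=(id\otimes D)\Delta+(D\otimes id)\Delta$. *)

theory Defs
  imports Complex_Main "HOL-Library.Poly_Mapping"
begin

text \<open>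
  The vector space over \<open>'k\<close> with basis (indexed by) \<open>'b\<close> is the type \<open>'b \<Rightarrow>\<^sub>0 'k\<close> of finitely supported
  functions. The library makes it an abelian group, but provides no scalar multiplication.
\<close>

definition scale :: "'k::field \<Rightarrow> ('b \<Rightarrow>\<^sub>0 'k) \<Rightarrow> ('b \<Rightarrow>\<^sub>0 'k)"
  where "scale c x = Poly_Mapping.map ((*) c) x"

definition basis_vec :: "'b \<Rightarrow> ('b \<Rightarrow>\<^sub>0 'k::field)"
  where "basis_vec b = Poly_Mapping.single b 1"

definition lin_extend :: "('k::field \<Rightarrow> 'v \<Rightarrow> 'v) \<Rightarrow> ('b \<Rightarrow> 'v) \<Rightarrow> ('b \<Rightarrow>\<^sub>0 'k) \<Rightarrow> 'v::ab_group_add"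
  where "lin_extend s f x = (\<Sum>b\<in>Poly_Mapping.keys x. s (Poly_Mapping.lookup x b) (f b))"

abbreviation linear_map :: "(('a \<Rightarrow>\<^sub>0 'k::field) \<Rightarrow> ('b \<Rightarrow>\<^sub>0 'k)) \<Rightarrow> bool"
  where "linear_map \<equiv> Vector_Spaces.linear scale scale"

lemma lookup_scale [simp]: "Poly_Mapping.lookup (scale c x) b = c * Poly_Mapping.lookup x b"
  by (simp add: scale_def Poly_Mapping.map.rep_eq when_def)

lemma vector_space_scale: "vector_space (scale :: 'k::field \<Rightarrow> ('b \<Rightarrow>\<^sub>0 'k) \<Rightarrow> _)"
  by unfold_locales (auto intro!: poly_mapping_eqI simp: lookup_add algebra_simps)

lemma basis_expansion:
  fixes x :: "'b \<Rightarrow>\<^sub>0 'k::field"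
  shows "x = (\<Sum>b\<in>Poly_Mapping.keys x. scale (Poly_Mapping.lookup x b) (basis_vec b))"
  by (rule poly_mapping_eqI)
    (auto simp: lookup_sum basis_vec_def lookup_single when_def in_keys_iff sum.delta'
      if_distrib[of "\<lambda>z. _ * z"] cong: if_cong)

lemma lin_extend_superset:
  assumes "vector_space s" "finite A" "Poly_Mapping.keys x \<subseteq> A"
  shows "lin_extend s f x = (\<Sum>b\<in>A. s (Poly_Mapping.lookup x b) (f b))"
proof -
  interpret vector_space s by fact
  show ?thesis
    unfolding lin_extend_def using assms(2,3)
    by (intro sum.mono_neutral_left) (auto simp: in_keys_iff)
qed

lemma linear_lin_extend:
  fixes f :: "'b \<Rightarrow> 'v::ab_group_add" and s :: "'k::field \<Rightarrow> 'v \<Rightarrow> 'v"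
  assumes "vector_space s"
  shows "Vector_Spaces.linear scale s (lin_extend s f)"
proof -
  interpret vector_space s by fact
  have add: "lin_extend s f (x + y) = lin_extend s f x + lin_extend s f y" for x y
  proof -
    let ?A = "Poly_Mapping.keys x \<union> Poly_Mapping.keys y"
    have "Poly_Mapping.keys (x + y) \<subseteq> ?A" by (rule keys_add)
    then show ?thesis
      by (simp add: lin_extend_superset[OF assms, of ?A] lookup_add scale_left_distrib sum.distrib)
  qed
  have "lin_extend s f (scale c x) = s c (lin_extend s f x)" for c x
  proof -
    have "Poly_Mapping.keys (scale c x) \<subseteq> Poly_Mapping.keys x"
      by (auto simp: in_keys_iff)
    then show ?thesis
      by (simp add: lin_extend_superset[OF assms, of "Poly_Mapping.keys x"] scale_sum_right)
  qed
  with add show ?thesis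
    using assms vector_space_scale by (auto simp: Vector_Spaces.linear_iff)
qed

lemma lin_extend_basis_vec [simp]:
  assumes "vector_space s"
  shows "lin_extend s f (basis_vec b) = f b"
proof -
  interpret vector_space s by fact
  show ?thesis by (simp add: lin_extend_def basis_vec_def)
qed

lemma linear_eqI_basis_vec:
  assumes "Vector_Spaces.linear scale s g" "Vector_Spaces.linear scale s h"
    and "\<And>b. g (basis_vec b) = h (basis_vec b)"
  shows "g = h"
proof
  fix x
  interpret g: Vector_Spaces.linear scale s g by fact
  interpret h: Vector_Spaces.linear scale s h by fact
  show "g x = h x"
    by (subst (1 2) basis_expansion) (simp add: g.sum g.scale h.sum h.scale assms(3))
qed

text \<open>
  The tensor product of the spaces with bases \<open>'a\<close> and \<open>'b\<close> is the space with basis \<open>'a \<times> 'b\<close>,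
  the basis vector \<open>(a, b)\<close> being the pure tensor of the basis vectors \<open>a\<close> and \<open>b\<close>; that this is the
  tensor product in the usual sense is the universal property \<open>tensor_universal\<close> below.
\<close>

lift_definition tensor :: "('a \<Rightarrow>\<^sub>0 'k::field) \<Rightarrow> ('b \<Rightarrow>\<^sub>0 'k) \<Rightarrow> ('a \<times> 'b \<Rightarrow>\<^sub>0 'k)"  (infixr "\<otimes>" 75)
  is "\<lambda>x y (a, b). x a * y b"
proof -
  fix x :: "'a \<Rightarrow> 'k" and y :: "'b \<Rightarrow> 'k"
  assume "finite {a. x a \<noteq> 0}" "finite {b. y b \<noteq> 0}"
  then have "finite ({a. x a \<noteq> 0} \<times> {b. y b \<noteq> 0})" by simp
  then show "finite {p. (case p of (a, b) \<Rightarrow> x a * y b) \<noteq> 0}"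
    by (rule rev_finite_subset) auto
qed

definition tensor_map :: "(('a \<Rightarrow>\<^sub>0 'k::field) \<Rightarrow> ('c \<Rightarrow>\<^sub>0 'k)) \<Rightarrow> (('b \<Rightarrow>\<^sub>0 'k) \<Rightarrow> ('d \<Rightarrow>\<^sub>0 'k))
    \<Rightarrow> ('a \<times> 'b \<Rightarrow>\<^sub>0 'k) \<Rightarrow> ('c \<times> 'd \<Rightarrow>\<^sub>0 'k)"
  where "tensor_map f g = lin_extend scale (\<lambda>(a, b). f (basis_vec a) \<otimes> g (basis_vec b))"

lemma lookup_tensor [simp]:
  "Poly_Mapping.lookup (x \<otimes> y) (a, b) = Poly_Mapping.lookup x a * Poly_Mapping.lookup y b"
  by transfer simp

lemma basis_vec_tensor: "basis_vec a \<otimes> basis_vec b = basis_vec (a, b)"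
  by (rule poly_mapping_eqI) (auto simp: basis_vec_def lookup_single when_def split: if_splits)

lemma linear_tensor_left: "linear_map (\<lambda>x. x \<otimes> y)"
  and linear_tensor_right: "linear_map (\<lambda>y. x \<otimes> y)"
  by (auto simp: Vector_Spaces.linear_iff vector_space_scale lookup_add algebra_simps
      intro!: poly_mapping_eqI)

lemma tensor_universal:
  fixes h :: "('a \<Rightarrow>\<^sub>0 'k::field) \<Rightarrow> ('b \<Rightarrow>\<^sub>0 'k) \<Rightarrow> 'v::ab_group_add" and s :: "'k \<Rightarrow> 'v \<Rightarrow> 'v"
  assumes "\<And>y. Vector_Spaces.linear scale s (\<lambda>x. h x y)"
    and "\<And>x. Vector_Spaces.linear scale s (h x)"
  shows "\<exists>!H. Vector_Spaces.linear scale s H \<and> (\<forall>x y. H (x \<otimes> y) = h x y)"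
proof (rule ex1I)
  let ?H = "lin_extend s (\<lambda>(a, b). h (basis_vec a) (basis_vec b))"
  have vs: "vector_space s"
    using assms(2) by (simp add: Vector_Spaces.linear_iff)
  have lin: "Vector_Spaces.linear scale s ?H"
    by (rule linear_lin_extend[OF vs])
  have "(\<lambda>y. ?H (x \<otimes> y)) = h x" for x
  proof (rule linear_eqI_basis_vec[where s = s])
    show "Vector_Spaces.linear scale s (\<lambda>y. ?H (x \<otimes> y))"
      using Vector_Spaces.linear_compose[OF linear_tensor_right lin] by (simp add: o_def)
    show "?H (x \<otimes> basis_vec b) = h x (basis_vec b)" for b
    proof -
      have "(\<lambda>x. ?H (x \<otimes> basis_vec b)) = (\<lambda>x. h x (basis_vec b))"
      proof (rule linear_eqI_basis_vec[where s = s])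
        show "Vector_Spaces.linear scale s (\<lambda>x. ?H (x \<otimes> basis_vec b))"
          using Vector_Spaces.linear_compose[OF linear_tensor_left lin] by (simp add: o_def)
      qed (simp_all add: assms basis_vec_tensor vs)
      then show ?thesis by (rule fun_cong)
    qed
  qed (rule assms)
  then show "Vector_Spaces.linear scale s ?H \<and> (\<forall>x y. ?H (x \<otimes> y) = h x y)"
    using lin by (auto dest: fun_cong)
  fix H assume H: "Vector_Spaces.linear scale s H \<and> (\<forall>x y. H (x \<otimes> y) = h x y)"
  show "H = ?H"
  proof (rule linear_eqI_basis_vec[where s = s])
    show "H (basis_vec p) = ?H (basis_vec p)" for p
      using H by (cases p) (simp add: vs flip: basis_vec_tensor,
        simp add: basis_vec_tensor vs)
  qed (use H lin in auto)
qed

lemma tensor_map_tensor: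
  assumes f: "linear_map f" and g: "linear_map g"
  shows "tensor_map f g (x \<otimes> y) = f x \<otimes> g y"
proof -
  have "Vector_Spaces.linear scale scale (\<lambda>x. f x \<otimes> g y)" for y
    using Vector_Spaces.linear_compose[OF f linear_tensor_left] by (simp add: o_def)
  moreover have "Vector_Spaces.linear scale scale (\<lambda>y. f x \<otimes> g y)" for x
    using Vector_Spaces.linear_compose[OF g linear_tensor_right] by (simp add: o_def)
  ultimately obtain H where H: "linear_map H" "\<And>x y. H (x \<otimes> y) = f x \<otimes> g y"
    using tensor_universal[of scale "\<lambda>x y. f x \<otimes> g y"] by auto
  have "tensor_map f g = H"
  proof (rule linear_eqI_basis_vec[OF _ H(1)])
    show "linear_map (tensor_map f g)"
      unfolding tensor_map_def by (rule linear_lin_extend[OF vector_space_scale])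
    show "tensor_map f g (basis_vec p) = H (basis_vec p)" for p
      using H(2)[of "basis_vec (fst p)" "basis_vec (snd p)"]
      by (cases p) (simp add: tensor_map_def basis_vec_tensor vector_space_scale)
  qed
  then show ?thesis by (simp add: H(2))
qed

text \<open>The canonical isomorphism \<open>(A \<otimes> B) \<otimes> C \<cong> A \<otimes> (B \<otimes> C)\<close>.\<close>

definition tensor_assoc :: "(('a \<times> 'b) \<times> 'c \<Rightarrow>\<^sub>0 'k::field) \<Rightarrow> ('a \<times> ('b \<times> 'c) \<Rightarrow>\<^sub>0 'k)"
  where "tensor_assoc =
    lin_extend scale (\<lambda>((a, b), c). basis_vec a \<otimes> (basis_vec b \<otimes> basis_vec c))"

definition coassociative_coalgebra :: "(('b \<Rightarrow>\<^sub>0 'k::field) \<Rightarrow> ('b \<times> 'b \<Rightarrow>\<^sub>0 'k)) \<Rightarrow> bool"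
  where "coassociative_coalgebra \<Delta> \<longleftrightarrow> linear_map \<Delta> \<and>
    (\<forall>x. tensor_assoc (tensor_map \<Delta> id (\<Delta> x)) = tensor_map id \<Delta> (\<Delta> x))"

definition leibniz_coderivation ::
    "(('b \<Rightarrow>\<^sub>0 'k::field) \<Rightarrow> ('b \<times> 'b \<Rightarrow>\<^sub>0 'k)) \<Rightarrow> (('b \<Rightarrow>\<^sub>0 'k) \<Rightarrow> ('b \<Rightarrow>\<^sub>0 'k)) \<Rightarrow> bool"
  where "leibniz_coderivation \<Delta> D \<longleftrightarrow> coassociative_coalgebra \<Delta> \<and> linear_map D \<and>
    (\<forall>x. \<Delta> (D x) = tensor_map id D (\<Delta> x) + tensor_map D id (\<Delta> x))"

text \<open>
  The indices range over a finite type \<open>'n\<close>, with \<open>n = CARD('n) \<ge> 1\<close> since types are nonempty.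
  For scalars in \<open>\<real>\<close> or \<open>\<complex>\<close>, take \<open>'k\<close> of class \<open>real_normed_field\<close>: by the Gelfand--Mazur theorem its
  instances are exactly these two, up to isomorphism.
\<close>

abbreviation U :: "'n \<Rightarrow> 'n \<Rightarrow> ('n \<times> 'n \<Rightarrow>\<^sub>0 'k::field)"
  where "U i j \<equiv> basis_vec (i, j)"

definition matrix_comult ::
    "('n::finite \<times> 'n \<Rightarrow>\<^sub>0 'k::field) \<Rightarrow> (('n \<times> 'n) \<times> ('n \<times> 'n) \<Rightarrow>\<^sub>0 'k)"
  where "matrix_comult = lin_extend scale (\<lambda>(i, j). \<Sum>k\<in>UNIV. U i k \<otimes> U k j)"

definition D_map :: "('n::finite \<times> 'n \<Rightarrow>\<^sub>0 'k::field) \<Rightarrow> ('n \<times> 'n \<Rightarrow>\<^sub>0 'k)"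
  where "D_map = lin_extend scale (\<lambda>(i, j). \<Sum>k\<in>UNIV. (U k j - U i k))"

lemma matrix_comult_U: "matrix_comult (U i j) = (\<Sum>k\<in>UNIV. U i k \<otimes> U k j)"
  and D_map_U: "D_map (U i j) = (\<Sum>k\<in>UNIV. (U k j - U i k))"
  by (simp_all add: matrix_comult_def D_map_def vector_space_scale)

lemma linear_tensor_map: "linear_map (tensor_map f g)"
  and linear_tensor_assoc: "linear_map tensor_assoc"
  and linear_matrix_comult: "linear_map matrix_comult"
  and linear_D_map: "linear_map D_map"
  unfolding tensor_map_def tensor_assoc_def matrix_comult_def D_map_def
  by (rule linear_lin_extend[OF vector_space_scale])+

lemma coassociative_matrix_comult: "coassociative_coalgebra
    (matrix_comult :: ('n::finite \<times> 'n \<Rightarrow>\<^sub>0 'k::field) \<Rightarrow> _)"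
proof -
  let ?\<Delta> = "matrix_comult :: ('n \<times> 'n \<Rightarrow>\<^sub>0 'k) \<Rightarrow> _"
  interpret A: Vector_Spaces.linear scale scale "tensor_assoc ::
      ((('n \<times> 'n) \<times> 'n \<times> 'n) \<times> 'n \<times> 'n \<Rightarrow>\<^sub>0 'k) \<Rightarrow> _"
    by (rule linear_tensor_assoc)
  interpret L: Vector_Spaces.linear scale scale "tensor_map ?\<Delta> id"
    by (rule linear_tensor_map)
  interpret R: Vector_Spaces.linear scale scale "tensor_map id ?\<Delta>"
    by (rule linear_tensor_map)
  have l: "tensor_map ?\<Delta> id (U i k \<otimes> U k j) = (\<Sum>l\<in>UNIV. (U i l \<otimes> U l k) \<otimes> U k j)" for i j k
  proof -
    interpret T: Vector_Spaces.linear scale scale "\<lambda>x. x \<otimes> (U k j :: 'n \<times> 'n \<Rightarrow>\<^sub>0 'k)"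
      by (rule linear_tensor_left)
    show ?thesis
      by (simp add: tensor_map_def basis_vec_tensor vector_space_scale matrix_comult_U
          T.sum[unfolded basis_vec_tensor])
  qed
  have r: "tensor_map id ?\<Delta> (U i k \<otimes> U k j) = (\<Sum>l\<in>UNIV. U i k \<otimes> (U k l \<otimes> U l j))" for i j k
  proof -
    interpret T: Vector_Spaces.linear scale scale "\<lambda>x. (U i k :: 'n \<times> 'n \<Rightarrow>\<^sub>0 'k) \<otimes> x"
      by (rule linear_tensor_right)
    show ?thesis
      by (simp add: tensor_map_def basis_vec_tensor vector_space_scale matrix_comult_U
          T.sum[unfolded basis_vec_tensor])
  qed
  have a: "tensor_assoc ((U i l \<otimes> U l k) \<otimes> U k j) =
      (U i l \<otimes> (U l k \<otimes> U k j) :: _ \<Rightarrow>\<^sub>0 'k)" for i j k l :: 'n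
    by (simp add: tensor_assoc_def basis_vec_tensor vector_space_scale)
  have "(\<lambda>x. tensor_assoc (tensor_map ?\<Delta> id (?\<Delta> x))) = (\<lambda>x. tensor_map id ?\<Delta> (?\<Delta> x))"
  proof (rule linear_eqI_basis_vec[where s = scale])
    show "linear_map (\<lambda>x. tensor_assoc (tensor_map ?\<Delta> id (?\<Delta> x)))"
      using Vector_Spaces.linear_compose[OF Vector_Spaces.linear_compose[OF
          linear_matrix_comult linear_tensor_map] linear_tensor_assoc]
      by (simp add: o_def)
    show "linear_map (\<lambda>x. tensor_map id ?\<Delta> (?\<Delta> x))"
      using Vector_Spaces.linear_compose[OF linear_matrix_comult linear_tensor_map]
      by (simp add: o_def)
    show "tensor_assoc (tensor_map ?\<Delta> id (?\<Delta> (basis_vec p))) =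
      tensor_map id ?\<Delta> (?\<Delta> (basis_vec p))" for p
      by (cases p) (simp add: matrix_comult_U L.sum R.sum A.sum l r a, rule sum.swap)
  qed
  then show ?thesis
    by (auto simp: coassociative_coalgebra_def linear_matrix_comult dest: fun_cong)
qed

end

theory Submission
  imports Defs
begin

text \<open>
  The map \<open>D\<close> is the coinner coderivation of the linear functional \<open>\<phi>\<close> with \<open>\<phi> (U i j) = 1\<close> for
  all \<open>i, j\<close>: writing \<open>F\<close> for the ground field and identifying \<open>F \<otimes> C\<close> and \<open>C \<otimes> F\<close> with \<open>C\<close>,
  \<open>D = (\<phi> \<otimes> id) \<Delta> - (id \<otimes> \<phi>) \<Delta>\<close>. Dually, it is the commutator with the all-ones matrix, and so
  it is a coderivation for the same reason that a commutator is a derivation: by coassociativity,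
  \<open>(id \<otimes> D) \<Delta>\<close> and \<open>(D \<otimes> id) \<Delta>\<close> both contain the threefold coproduct with \<open>\<phi>\<close> applied to
  its middle factor, with opposite signs, and what remains after cancellation is \<open>\<Delta> D\<close>.

  Both sides of the Leibniz identity are linear, so the cancellation need only be seen on the
  basis elements \<open>U i j\<close>. This is done in \<open>D_map_leibniz_U\<close>, where the middle term is
  \<open>\<Sum>l k. U i l \<otimes> U k j\<close>, the tensor product of a row sum and a column sum.
\<close>

lemma D_map_leibniz_U:
  fixes i j :: "'n::finite"
  shows "matrix_comult (D_map (U i j :: _ \<Rightarrow>\<^sub>0 'k::field)) =
    tensor_map id D_map (matrix_comult (U i j)) + tensor_map D_map id (matrix_comult (U i j))"
proof -
  interpret M: Vector_Spaces.linear scale scale "matrix_comult :: ('n \<times> 'n \<Rightarrow>\<^sub>0 'k) \<Rightarrow> _"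
    by (rule linear_matrix_comult)
  interpret R: Vector_Spaces.linear scale scale
    "tensor_map id D_map :: (('n \<times> 'n) \<times> ('n \<times> 'n) \<Rightarrow>\<^sub>0 'k) \<Rightarrow> (('n \<times> 'n) \<times> ('n \<times> 'n) \<Rightarrow>\<^sub>0 'k)"
    by (rule linear_tensor_map)
  interpret L: Vector_Spaces.linear scale scale
    "tensor_map D_map id :: (('n \<times> 'n) \<times> ('n \<times> 'n) \<Rightarrow>\<^sub>0 'k) \<Rightarrow> (('n \<times> 'n) \<times> ('n \<times> 'n) \<Rightarrow>\<^sub>0 'k)"
    by (rule linear_tensor_map)
  have lin_id: "linear_map (id :: ('n \<times> 'n \<Rightarrow>\<^sub>0 'k) \<Rightarrow> _)"
    by (simp add: Vector_Spaces.linear_iff vector_space_scale)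
  have id_D: "tensor_map id D_map (U i l \<otimes> U l j) =
      (\<Sum>k\<in>UNIV. U i l \<otimes> U k j) - (\<Sum>k\<in>UNIV. U i l \<otimes> U l k :: _ \<Rightarrow>\<^sub>0 'k)" for l
  proof -
    interpret T: Vector_Spaces.linear scale scale "\<lambda>x. (U i l :: 'n \<times> 'n \<Rightarrow>\<^sub>0 'k) \<otimes> x"
      by (rule linear_tensor_right)
    show ?thesis
      by (simp add: tensor_map_tensor lin_id linear_D_map D_map_U T.sum T.diff sum_subtractf)
  qed
  have D_id: "tensor_map D_map id (U i l \<otimes> U l j) =
      (\<Sum>k\<in>UNIV. U k l \<otimes> U l j) - (\<Sum>k\<in>UNIV. U i k \<otimes> U l j :: _ \<Rightarrow>\<^sub>0 'k)" for l
  proof -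
    interpret T: Vector_Spaces.linear scale scale "\<lambda>x. x \<otimes> (U l j :: 'n \<times> 'n \<Rightarrow>\<^sub>0 'k)"
      by (rule linear_tensor_left)
    show ?thesis
      by (simp add: tensor_map_tensor lin_id linear_D_map D_map_U T.sum T.diff sum_subtractf)
  qed
  let ?col = "\<Sum>l\<in>UNIV. \<Sum>k\<in>UNIV. U k l \<otimes> (U l j :: _ \<Rightarrow>\<^sub>0 'k)"
  let ?row = "\<Sum>l\<in>UNIV. \<Sum>k\<in>UNIV. U i l \<otimes> (U l k :: _ \<Rightarrow>\<^sub>0 'k)"
  let ?mid = "\<Sum>l\<in>UNIV. \<Sum>k\<in>UNIV. U i l \<otimes> (U k j :: _ \<Rightarrow>\<^sub>0 'k)"
  have "matrix_comult (D_map (U i j :: _ \<Rightarrow>\<^sub>0 'k)) =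
      (\<Sum>k\<in>UNIV. \<Sum>l\<in>UNIV. U k l \<otimes> U l j) - (\<Sum>k\<in>UNIV. \<Sum>l\<in>UNIV. U i l \<otimes> U l k)"
    by (simp add: D_map_U M.sum M.diff matrix_comult_U sum_subtractf)
  also have "\<dots> = ?col - ?row"
    by (intro arg_cong2[where f = minus]) (rule sum.swap)+
  also have "\<dots> = (?mid - ?row) + (?col - ?mid)"
    by simp
  also have "?mid - ?row = tensor_map id D_map (matrix_comult (U i j))"
    by (simp add: matrix_comult_U R.sum id_D sum_subtractf)
  also have "?mid = (\<Sum>l\<in>UNIV. \<Sum>k\<in>UNIV. U i k \<otimes> U l j)"
    by (rule sum.swap)
  also have "?col - \<dots> = tensor_map D_map id (matrix_comult (U i j))"
    by (simp add: matrix_comult_U L.sum D_id sum_subtractf)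
  finally show ?thesis .
qed

theorem proposition4p7:
  shows "leibniz_coderivation
    (matrix_comult :: ('n::finite \<times> 'n \<Rightarrow>\<^sub>0 'k::real_normed_field) \<Rightarrow> (('n \<times> 'n) \<times> ('n \<times> 'n) \<Rightarrow>\<^sub>0 'k))
    D_map"
proof -
  let ?\<Delta> = "matrix_comult :: ('n \<times> 'n \<Rightarrow>\<^sub>0 'k) \<Rightarrow> _"
  have "(\<lambda>x. ?\<Delta> (D_map x)) = (\<lambda>x. tensor_map id D_map (?\<Delta> x) + tensor_map D_map id (?\<Delta> x))"
  proof (rule linear_eqI_basis_vec[where s = scale])
    show "linear_map (\<lambda>x. ?\<Delta> (D_map x))"
      using Vector_Spaces.linear_compose[OF linear_D_map linear_matrix_comult]
      by (simp add: o_def)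
    have "linear_map (\<lambda>x. tensor_map f g (?\<Delta> x))" for f g :: "('n \<times> 'n \<Rightarrow>\<^sub>0 'k) \<Rightarrow> ('n \<times> 'n \<Rightarrow>\<^sub>0 'k)"
      using Vector_Spaces.linear_compose[OF linear_matrix_comult linear_tensor_map]
      by (simp add: o_def)
    then show "linear_map (\<lambda>x. tensor_map id D_map (?\<Delta> x) + tensor_map D_map id (?\<Delta> x))"
      by (simp add: Vector_Spaces.linear_iff vector_space.vector_space_assms(1)[OF vector_space_scale]
          algebra_simps)
    show "?\<Delta> (D_map (basis_vec p)) =
        tensor_map id D_map (?\<Delta> (basis_vec p)) + tensor_map D_map id (?\<Delta> (basis_vec p))" for p
      using D_map_leibniz_U[of "fst p" "snd p"] by simp
  qed
  then show ?thesis
    by (auto simp: leibniz_coderivation_def coassociative_matrix_comult linear_D_map dest: fun_cong)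
qed

end
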